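(* Let $k<N$ be positive integers. (1) There exist nonnegative classical solutions of $\mathcal{P}^-_k(D^2u)=0$ in $\mathbb{R}^N$ which are not constant. (2) If $k=1$ or $k=2$ and $u$ is a nonnegative viscosity supersolution of $\mathcal{P}^+_k(D^2u)=0$ in $\mathbb{R}^N$, then $u$ is constant. If $k>2$, there are nonnegative classical supersolutions of $\mathcal{P}^+_k(D^2u)=0$ in $\mathbb{R}^N$ which are not constant.
   Context: For a symmetric $N\times N$ real matrix $X$ with ordered eigenvalues $\lambda_1(X)\le\cdots\le\lambda_N(X)$ and an integer $1\le k\le N$, set $\mathcal{P}^-_k(X)=\sum_{i=1}^k\lambda_i(X)$ and $\mathcal{P}^+_k(X)=\sum_{i=N-k+1}^N\lambda_i(X)$. Let $F$ be $\mathcal{P}^-_k$ or $\mathcal{P}^+_k$. A viscosity supersolution of $F(D^2u)=0$ in an open set $\Omega\subset\mathbb{R}^N$ is a lower semicontinuous function $u:\Omega\to\mathbb{R}$ such that, for every $x_0\in\Omega$ and every $C^2$ function $\varphi$ such that $u-\varphi$ has a local minimum at $x_0$, one has $F(D^2\varphi(x_0))\le 0$. A classical solution (resp. supersolution) is a function $u\in C^2(\Omega)$ satisfying $F(D^2u(x))=0$ (resp. $\le 0$) at every point of $\Omega$. *)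

theory Defs
  imports "HOL-Analysis.Analysis" "HOL-Computational_Algebra.Polynomial"
begin

definition charpoly :: "real^'n^'n \<Rightarrow> real poly" where
  "charpoly X = det (\<chi> i j. (if i = j then [:0, 1:] else 0) - [:X $ i $ j:])"

(* lambda_i(X) for 1 \<le> i \<le> CARD('n), counted with multiplicity.  Meant for symmetric X,
   whose characteristic polynomial splits over the reals; otherwise the list is too short. *)
definition eigval :: "real^'n^'n \<Rightarrow> nat \<Rightarrow> real" where
  "eigval X i = sorted_list_of_multiset (proots (charpoly X)) ! (i - 1)"

definition P_minus :: "nat \<Rightarrow> real^'n^'n \<Rightarrow> real" where
  "P_minus k X = (\<Sum>i=1..k. eigval X i)"

definition P_plus :: "nat \<Rightarrow> real^'n^'n \<Rightarrow> real" where
  "P_plus k X = (\<Sum>i=CARD('n) - k + 1..CARD('n). eigval X i)"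

definition pderivative :: "'n \<Rightarrow> (real^'n \<Rightarrow> real) \<Rightarrow> real^'n \<Rightarrow> real" where
  "pderivative i f x = frechet_derivative f (at x) (axis i 1)"

definition hessian :: "(real^'n \<Rightarrow> real) \<Rightarrow> real^'n \<Rightarrow> real^'n^'n" where
  "hessian f x = (\<chi> i j. pderivative i (pderivative j f) x)"

(* In this definition and the ones below, S and \<Omega> are meant to be open.  The differentiability
   conditions make every value of frechet_derivative used here the genuine derivative. *)
definition C2_on :: "(real^'n) set \<Rightarrow> (real^'n \<Rightarrow> real) \<Rightarrow> bool" where
  "C2_on S f \<longleftrightarrow>
     f differentiable_on S \<and>
     (\<forall>i. pderivative i f differentiable_on S) \<and>
     (\<forall>i j. continuous_on S (pderivative i (pderivative j f)))"

definition lsc_on :: "'a::topological_space set \<Rightarrow> ('a \<Rightarrow> real) \<Rightarrow> bool" where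
  "lsc_on S u \<longleftrightarrow> (\<forall>x\<in>S. \<forall>c < u x. \<forall>\<^sub>F y in at x within S. c < u y)"

definition local_min_at :: "'a::topological_space set \<Rightarrow> ('a \<Rightarrow> real) \<Rightarrow> 'a \<Rightarrow> bool" where
  "local_min_at S g x0 \<longleftrightarrow> (\<forall>\<^sub>F x in at x0 within S. g x0 \<le> g x)"

definition viscosity_supersolution ::
    "(real^'n^'n \<Rightarrow> real) \<Rightarrow> (real^'n) set \<Rightarrow> (real^'n \<Rightarrow> real) \<Rightarrow> bool" where
  "viscosity_supersolution F \<Omega> u \<longleftrightarrow>
     lsc_on \<Omega> u \<and>
     (\<forall>x0\<in>\<Omega>. \<forall>\<phi>. C2_on \<Omega> \<phi> \<and> local_min_at \<Omega> (\<lambda>x. u x - \<phi> x) x0 \<longrightarrow> F (hessian \<phi> x0) \<le> 0)"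

definition classical_solution ::
    "(real^'n^'n \<Rightarrow> real) \<Rightarrow> (real^'n) set \<Rightarrow> (real^'n \<Rightarrow> real) \<Rightarrow> bool" where
  "classical_solution F \<Omega> u \<longleftrightarrow> C2_on \<Omega> u \<and> (\<forall>x\<in>\<Omega>. F (hessian u x) = 0)"

definition classical_supersolution ::
    "(real^'n^'n \<Rightarrow> real) \<Rightarrow> (real^'n) set \<Rightarrow> (real^'n \<Rightarrow> real) \<Rightarrow> bool" where
  "classical_supersolution F \<Omega> u \<longleftrightarrow> C2_on \<Omega> u \<and> (\<forall>x\<in>\<Omega>. F (hessian u x) \<le> 0)"

end

theory Submission
  imports Defs
begin

text \<open>
Every Hessian needed has the form \<open>c I + d v v\<^sup>T\<close> with \<open>d \<ge> 0\<close>, whose eigenvalues are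
\<open>c\<close>, repeated \<open>N - 1\<close> times, and \<open>c + d |v|\<^sup>2\<close>. Hence \<open>P_minus k\<close> equals \<open>k c\<close> on it for
\<open>k < N\<close>, and \<open>P_plus k\<close> equals \<open>k c + d |v|\<^sup>2\<close> for \<open>1 \<le> k \<le> N\<close>.

For \<open>P_minus k\<close> the square of one coordinate has \<open>c = 0\<close>, so it is a nonconstant solution.

For \<open>P_plus k\<close> everything rests on the functions \<open>(s + |x - y|\<^sup>2)\<^sup>-\<^sup>a\<close>, the smooth version of the
powers of the distance. Up to a positive factor, \<open>P_plus k\<close> of the Hessian is
\<open>2 (a + 1) |x - y|\<^sup>2 - k (s + |x - y|\<^sup>2)\<close>
(lemma \<open>P_plus_hessian_radial_power\<close>).
If \<open>k \<ge> 3\<close>, the choice \<open>a = 1/2\<close> makes this nonpositive everywhere, which gives the nonconstant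
supersolution. If \<open>k \<le> 2\<close>, it is positive as soon as \<open>s < a |x - y|\<^sup>2\<close>, for every \<open>a > 0\<close>, however
small: outside a ball there are strict subsolutions that tend to \<open>0\<close> at infinity, arbitrarily slowly.
This is the behaviour that makes the plane parabolic, and the Liouville property follows as it does for
superharmonic functions in the plane. A nonnegative supersolution lies above each such
barrier that it dominates on a sphere (\<open>supersolution_above_barrier\<close>); letting \<open>a\<close> and \<open>s\<close>
tend to \<open>0\<close>, the barrier becomes constant, so the minimum over any ball is a minimum over the
whole space (\<open>supersolution_min_on_ball_global\<close>). The global minimum is therefore attained in every
ball, that is, on a dense set, and lower semicontinuity spreads it to every point.
\<close>

section \<open>Spectrum of a rank-one perturbation of a scalar matrix\<close>

definition scalar_plus_rank1 :: "real \<Rightarrow> real \<Rightarrow> real^'n \<Rightarrow> real^'n^'n" where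
  "scalar_plus_rank1 c d v = (\<chi> i j. (if i = j then c else 0) + d * v $ i * v $ j)"

lemma scalar_plus_rank1_mult_vec:
  "scalar_plus_rank1 c d v *v x = c *\<^sub>R x + (d * (v \<bullet> x)) *\<^sub>R v"
  by (simp add: vec_eq_iff scalar_plus_rank1_def matrix_vector_mult_def inner_vec_def
      distrib_right sum.distrib sum_distrib_left sum_distrib_right if_distrib[of "\<lambda>z. z * _"] cong: if_cong)
     (simp add: mult_ac)

text \<open>
The matrix of \<open>f\<close> conjugates the one operator into the other: an orthogonal map fixes \<open>c I\<close> and
carries the rank-one part in direction \<open>v\<close> to the one in direction \<open>f v\<close>.
\<close>

lemma det_scalar_plus_rank1_orthogonal:
  fixes f :: "real^'n \<Rightarrow> real^'n"
  assumes "orthogonal_transformation f"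
  shows "det (scalar_plus_rank1 c d (f v)) = det (scalar_plus_rank1 c d v)"
proof -
  define Q where "Q = matrix f"
  have Q: "orthogonal_matrix Q" and lin: "linear f"
    using assms by (auto simp: orthogonal_transformation_matrix Q_def)
  have Qf: "Q *v x = f x" for x
    using lin by (simp add: Q_def)
  have QQ: "Q ** transpose Q = mat 1"
    using Q by (simp add: orthogonal_matrix_def)
  have "(Q ** scalar_plus_rank1 c d v ** transpose Q) *v x = scalar_plus_rank1 c d (f v) *v x" for x
  proof -
    have "(Q ** scalar_plus_rank1 c d v ** transpose Q) *v x
        = Q *v (scalar_plus_rank1 c d v *v (transpose Q *v x))"
      by (simp add: matrix_vector_mul_assoc matrix_mul_assoc del: transpose_matrix_vector)
    also have "\<dots> = c *\<^sub>R (Q *v (transpose Q *v x)) + (d * (v \<bullet> (transpose Q *v x))) *\<^sub>R (Q *v v)"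
      by (simp add: scalar_plus_rank1_mult_vec matrix_vector_right_distrib matrix_vector_mult_scaleR)
    also have "Q *v (transpose Q *v x) = x"
      by (simp add: matrix_vector_mul_assoc QQ del: transpose_matrix_vector)
    also have "v \<bullet> (transpose Q *v x) = f v \<bullet> x"
      using dot_lmul_matrix[of x Q v] by (simp add: Qf inner_commute)
    finally show ?thesis
      by (simp add: scalar_plus_rank1_mult_vec Qf)
  qed
  then have "scalar_plus_rank1 c d (f v) = Q ** scalar_plus_rank1 c d v ** transpose Q"
    by (simp add: matrix_eq)
  then have "det (scalar_plus_rank1 c d (f v)) = det (scalar_plus_rank1 c d v) * det (Q ** transpose Q)"
    by (simp add: det_mul)
  then show ?thesis
    by (simp add: QQ)
qed

text \<open>
Rotating \<open>v\<close> onto a coordinate axis makes the matrix diagonal.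
\<close>

lemma det_scalar_plus_rank1:
  fixes v :: "real^'n"
  shows "det (scalar_plus_rank1 c d v) = c ^ (CARD('n) - 1) * (c + d * (norm v)\<^sup>2)"
proof -
  obtain i0 :: 'n where True by simp
  define w :: "real^'n" where "w = norm v *\<^sub>R axis i0 1"
  have w: "w $ i = (if i = i0 then norm v else 0)" for i
    by (simp add: w_def axis_def)
  have "norm v = norm w"
    by (simp add: w_def)
  then obtain f where f: "orthogonal_transformation f" "f v = w"
    using orthogonal_transformation_exists by blast
  have "det (scalar_plus_rank1 c d v) = det (scalar_plus_rank1 c d w)"
    using det_scalar_plus_rank1_orthogonal[OF f(1), of c d v] f(2) by simp
  also have "\<dots> = (\<Prod>i\<in>UNIV. scalar_plus_rank1 c d w $ i $ i)"
    by (rule det_diagonal) (auto simp: scalar_plus_rank1_def w)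
  also have "\<dots> = scalar_plus_rank1 c d w $ i0 $ i0
      * (\<Prod>i\<in>UNIV - {i0}. scalar_plus_rank1 c d w $ i $ i)"
    by (rule prod.remove) auto
  also have "(\<Prod>i\<in>UNIV - {i0}. scalar_plus_rank1 c d w $ i $ i) = (\<Prod>i\<in>UNIV - {i0}. c)"
    by (rule prod.cong) (auto simp: scalar_plus_rank1_def w)
  finally show ?thesis
    by (simp add: scalar_plus_rank1_def w power2_eq_square mult_ac)
qed

text \<open>
Evaluation reduces the characteristic polynomial to real determinants; two real polynomials with
the same values coincide.
\<close>

lemma poly_charpoly: "poly (charpoly X) t = det (mat t - X)"
  unfolding charpoly_def det_def poly_sum
  by (intro sum.cong refl) (auto simp: poly_prod mat_def intro!: prod.cong)

lemma charpoly_scalar_plus_rank1: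
  fixes v :: "real^'n"
  shows "charpoly (scalar_plus_rank1 c d v)
    = [:- c, 1:] ^ (CARD('n) - 1) * [:- (c + d * (norm v)\<^sup>2), 1:]"
proof (rule poly_ext)
  fix t
  have "mat t - scalar_plus_rank1 c d v = scalar_plus_rank1 (t - c) (- d) v"
    by (simp add: vec_eq_iff mat_def scalar_plus_rank1_def)
  then show "poly (charpoly (scalar_plus_rank1 c d v)) t
    = poly ([:- c, 1:] ^ (CARD('n) - 1) * [:- (c + d * (norm v)\<^sup>2), 1:]) t"
    by (simp add: poly_charpoly det_scalar_plus_rank1 algebra_simps)
qed

lemma eigval_scalar_plus_rank1:
  fixes v :: "real^'n"
  assumes "0 \<le> d" "1 \<le> i" "i \<le> CARD('n)"
  shows "eigval (scalar_plus_rank1 c d v) i = (if i < CARD('n) then c else c + d * (norm v)\<^sup>2)"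
proof -
  let ?e = "c + d * (norm v)\<^sup>2"
  let ?L = "replicate (CARD('n) - 1) c @ [?e]"
  have "repeat_mset n {#c#} = replicate_mset n c" for n
    by (rule multiset_eqI) simp
  then have "proots (charpoly (scalar_plus_rank1 c d v)) = mset ?L"
    by (simp add: charpoly_scalar_plus_rank1 proots_mult proots_power del: mult_pCons_right)
  \<comment> \<open>the sign of \<open>d\<close> decides at which end of the spectrum the exceptional eigenvalue stands\<close>
  moreover have "sorted ?L"
    using assms by (auto simp: sorted_append)
  ultimately have "sorted_list_of_multiset (proots (charpoly (scalar_plus_rank1 c d v))) = ?L"
    by (simp only: sorted_list_of_multiset_mset sorted_sort_id)
  then show ?thesis
    using assms by (auto simp: eigval_def nth_append)
qed

lemma P_minus_scalar_plus_rank1: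
  fixes v :: "real^'n"
  assumes "0 \<le> d" "k < CARD('n)"
  shows "P_minus k (scalar_plus_rank1 c d v) = k * c"
  using assms by (simp add: P_minus_def eigval_scalar_plus_rank1)

lemma P_plus_scalar_plus_rank1:
  fixes v :: "real^'n"
  assumes "0 \<le> d" "1 \<le> k" "k \<le> CARD('n)"
  shows "P_plus k (scalar_plus_rank1 c d v) = k * c + d * (norm v)\<^sup>2"
proof -
  have "P_plus k (scalar_plus_rank1 c d v)
      = (\<Sum>i = CARD('n) - k + 1..CARD('n). c + (if i = CARD('n) then d * (norm v)\<^sup>2 else 0))"
    unfolding P_plus_def using assms
    by (intro sum.cong refl) (auto simp: eigval_scalar_plus_rank1)
  also have "\<dots> = k * c + d * (norm v)\<^sup>2"
    using assms by (simp add: sum.distrib sum.delta)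
  finally show ?thesis .
qed

section \<open>Second derivatives of the comparison functions\<close>

lemma pderivative_eq:
  assumes "(f has_derivative f') (at x)"
  shows "pderivative i f x = f' (axis i 1)"
  using frechet_derivative_at[OF assms] by (simp add: pderivative_def)

lemma has_derivative_squared_coordinate:
  fixes x :: "real^'n"
  shows "((\<lambda>x. (x $ i)\<^sup>2) has_derivative (\<lambda>h. 2 * x $ i * h $ i)) (at x)"
  by (auto intro!: derivative_eq_intros bounded_linear_imp_has_derivative bounded_linear_vec_nth)

lemma squared_coordinate_C2_and_hessian:
  fixes i :: "'n::finite"
  shows "C2_on UNIV (\<lambda>x::real^'n. (x $ i)\<^sup>2)"
    and "hessian (\<lambda>x::real^'n. (x $ i)\<^sup>2) x = scalar_plus_rank1 0 2 (axis i 1)"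
proof -
  let ?u = "\<lambda>x::real^'n. (x $ i)\<^sup>2"
  have 1: "pderivative j ?u = (\<lambda>x. 2 * x $ i * axis j 1 $ i)" for j
    by (rule ext) (rule pderivative_eq[OF has_derivative_squared_coordinate])
  have D: "((\<lambda>x::real^'n. 2 * x $ i * axis j 1 $ i) has_derivative (\<lambda>h. 2 * h $ i * axis j 1 $ i)) (at x)"
    for j :: 'n and x
    by (rule bounded_linear_imp_has_derivative)
      (intro bounded_linear_mult_left bounded_linear_compose[OF bounded_linear_mult_right bounded_linear_vec_nth]
        bounded_linear_mult_const bounded_linear_const_mult bounded_linear_vec_nth)
  have 2: "pderivative l (pderivative j ?u) = (\<lambda>x. 2 * axis l 1 $ i * axis j 1 $ i)" for j l
    unfolding 1 by (rule ext) (rule pderivative_eq[OF D])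
  show "C2_on UNIV ?u"
    unfolding C2_on_def 2 unfolding 1 differentiable_on_def
    using differentiableI[OF has_derivative_squared_coordinate[of i]] differentiableI[OF D] by simp
  show "hessian ?u x = scalar_plus_rank1 0 2 (axis i 1)"
    by (auto simp: hessian_def 2 scalar_plus_rank1_def vec_eq_iff axis_def)
qed

definition radial_power :: "real \<Rightarrow> real \<Rightarrow> 'a::real_inner \<Rightarrow> 'a \<Rightarrow> real" where
  "radial_power s b y x = (s + (norm (x - y))\<^sup>2) powr b"

lemma radial_power_base_pos: "0 < s \<Longrightarrow> 0 < s + (norm z)\<^sup>2"
  by (simp add: add_pos_nonneg)

lemma radial_power_nonneg: "0 \<le> radial_power s b y x"
  by (simp add: radial_power_def)

lemma has_derivative_radial_power:
  assumes "0 < s"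
  shows "(radial_power s b y has_derivative
    (\<lambda>h. 2 * b * radial_power s (b - 1) y x * ((x - y) \<bullet> h))) (at x)"
proof -
  have pos: "0 < s + (norm (x - y))\<^sup>2"
    using assms by (rule radial_power_base_pos)
  have "((\<lambda>x. s + (norm (x - y))\<^sup>2) has_derivative (\<lambda>h. 2 * ((x - y) \<bullet> h))) (at x)"
    unfolding power2_norm_eq_inner by (auto intro!: derivative_eq_intros simp: inner_commute)
  from has_derivative_compose[OF this
      has_real_derivative_powr[OF pos, of b, unfolded has_field_derivative_def]]
  show ?thesis
    by (simp add: radial_power_def[abs_def] mult_ac)
qed

lemma radial_power_C2_and_hessian:
  fixes y :: "real^'n"
  assumes "0 < s"
  shows "C2_on UNIV (\<lambda>x. M * radial_power s b y x)"
    and "hessian (\<lambda>x. M * radial_power s b y x) x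
      = scalar_plus_rank1 (2 * b * M * radial_power s (b - 1) y x)
          (4 * b * (b - 1) * M * radial_power s (b - 2) y x) (x - y)"
proof -
  let ?u = "\<lambda>x. M * radial_power s b y x"
  note [derivative_intros] = has_derivative_radial_power[OF assms]
  have D1: "(?u has_derivative (\<lambda>h. M * (2 * b * radial_power s (b - 1) y x * ((x - y) \<bullet> h)))) (at x)" for x
    by (auto intro!: derivative_eq_intros)
  have 1: "pderivative j ?u = (\<lambda>x. 2 * b * M * radial_power s (b - 1) y x * (x - y) $ j)" for j
    by (rule ext, subst pderivative_eq[OF D1]) (simp add: inner_axis)
  have D2: "((\<lambda>x. 2 * b * M * radial_power s (b - 1) y x * (x - y) $ j) has_derivative
     (\<lambda>h. 2 * b * M * (radial_power s (b - 1) y x * h $ j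
        + 2 * (b - 1) * radial_power s (b - 2) y x * ((x - y) \<bullet> h) * (x - y) $ j))) (at x)" for x j
    by (auto intro!: derivative_eq_intros bounded_linear_imp_has_derivative bounded_linear_vec_nth
        simp: algebra_simps)
  have 2: "pderivative i (pderivative j ?u) = (\<lambda>x. 2 * b * M * (radial_power s (b - 1) y x * axis i 1 $ j
        + 2 * (b - 1) * radial_power s (b - 2) y x * (x - y) $ i * (x - y) $ j))" for i j
    unfolding 1 by (rule ext, subst pderivative_eq[OF D2]) (simp add: inner_axis)
  have cont: "continuous_on UNIV (radial_power s b y)" for b
    using has_derivative_radial_power[OF assms]
    by (metis continuous_at_imp_continuous_on has_derivative_continuous)
  show "C2_on UNIV ?u"
    unfolding C2_on_def 2 unfolding 1
  proof (intro conjI allI)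
    show "?u differentiable_on UNIV"
      using differentiableI[OF D1] by (simp add: differentiable_on_def)
    show "(\<lambda>x. 2 * b * M * radial_power s (b - 1) y x * (x - y) $ j) differentiable_on UNIV" for j
      using differentiableI[OF D2] by (simp add: differentiable_on_def)
    show "continuous_on UNIV (\<lambda>x. 2 * b * M * (radial_power s (b - 1) y x * axis i 1 $ j
        + 2 * (b - 1) * radial_power s (b - 2) y x * (x - y) $ i * (x - y) $ j))" for i j
      by (intro continuous_intros cont)
  qed
  show "hessian ?u x = scalar_plus_rank1 (2 * b * M * radial_power s (b - 1) y x)
          (4 * b * (b - 1) * M * radial_power s (b - 2) y x) (x - y)"
    by (auto simp: hessian_def 2 scalar_plus_rank1_def vec_eq_iff axis_def algebra_simps)
qed

text \<open>
With \<open>q = s + |x - y|\<^sup>2\<close> the scalar part of the Hessian is \<open>-2 a M q\<^sup>-\<^sup>a\<^sup>-\<^sup>1\<close> and the coefficient of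
the rank-one part is \<open>4 a (a + 1) M q\<^sup>-\<^sup>a\<^sup>-\<^sup>2\<close>. The latter is nonnegative, so the radial direction
carries the largest eigenvalue, and factoring out \<open>q\<^sup>-\<^sup>a\<^sup>-\<^sup>2\<close> leaves a bracket that is affine in
\<open>|x - y|\<^sup>2\<close>.
\<close>

lemma P_plus_hessian_radial_power:
  fixes y :: "real^'n"
  assumes "0 < s" "0 \<le> a" "0 \<le> M" "1 \<le> k" "k \<le> CARD('n)"
  shows "P_plus k (hessian (\<lambda>x. M * radial_power s (- a) y x) x)
    = 2 * a * M * radial_power s (- a - 2) y x
        * (2 * (a + 1) * (norm (x - y))\<^sup>2 - k * (s + (norm (x - y))\<^sup>2))"
proof -
  have pos: "0 < s + (norm (x - y))\<^sup>2"
    using assms by (intro radial_power_base_pos)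
  have "radial_power s (- a - 1) y x = (s + (norm (x - y))\<^sup>2) powr (1 + (- a - 2))"
    unfolding radial_power_def by (rule arg_cong[where f = "\<lambda>e. _ powr e"]) simp
  also have "\<dots> = (s + (norm (x - y))\<^sup>2) * radial_power s (- a - 2) y x"
    unfolding powr_add radial_power_def using pos by simp
  finally have *: "radial_power s (- a - 1) y x = (s + (norm (x - y))\<^sup>2) * radial_power s (- a - 2) y x" .
  have "0 \<le> 4 * (- a) * (- a - 1) * M * radial_power s (- a - 2) y x"
    using assms by (intro mult_nonneg_nonneg mult_nonpos_nonpos) (auto simp: radial_power_def)
  from P_plus_scalar_plus_rank1[OF this assms(4,5)]
  show ?thesis
    unfolding radial_power_C2_and_hessian(2)[OF assms(1)] * by (simp add: algebra_simps)
qed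

section \<open>Lower semicontinuous functions\<close>

lemma lsc_on_minus_continuous:
  assumes "lsc_on S u" "continuous_on S \<phi>"
  shows "lsc_on S (\<lambda>x. u x - \<phi> x)"
  unfolding lsc_on_def
proof (intro ballI allI impI)
  fix x c assume "x \<in> S" and c: "c < u x - \<phi> x"
  define e where "e = (u x - \<phi> x - c) / 2"
  have e: "0 < e" using c by (simp add: e_def)
  have "\<forall>\<^sub>F y in at x within S. u x - e < u y"
    using assms(1) \<open>x \<in> S\<close> e by (simp add: lsc_on_def)
  moreover have "\<forall>\<^sub>F y in at x within S. \<phi> y < \<phi> x + e"
    using assms(2) \<open>x \<in> S\<close> e by (intro order_tendstoD) (auto simp: continuous_on_def)
  ultimately show "\<forall>\<^sub>F y in at x within S. c < u y - \<phi> y"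
    by eventually_elim (use c in \<open>simp add: e_def field_simps\<close>)
qed

lemma lsc_on_UNIV_iff_open: "lsc_on UNIV u \<longleftrightarrow> (\<forall>c. open {x. c < u x})"
proof
  assume lsc: "lsc_on UNIV u"
  show "\<forall>c. open {x. c < u x}"
  proof
    fix c
    show "open {x. c < u x}"
      unfolding open_subopen[of "{x. c < u x}"]
    proof
      fix x assume x: "x \<in> {x. c < u x}"
      then have "\<forall>\<^sub>F y in at x. c < u y"
        using lsc by (simp add: lsc_on_def)
      then have "\<forall>\<^sub>F y in nhds x. c < u y"
        unfolding eventually_at_filter by eventually_elim (use x in auto)
      then show "\<exists>T. open T \<and> x \<in> T \<and> T \<subseteq> {x. c < u x}"
        unfolding eventually_nhds by blast
    qed
  qed
next
  assume "\<forall>c. open {x. c < u x}"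
  then have "\<forall>\<^sub>F y in at x. y \<in> {x. c < u x}" if "c < u x" for c x
    using that by (intro eventually_at_in_open') auto
  then show "lsc_on UNIV u"
    by (simp add: lsc_on_def)
qed

text \<open>
If no point of \<open>K\<close> were a minimizer, the open sets \<open>{x. u z < u x}\<close> with \<open>z \<in> K\<close> would cover \<open>K\<close>; in
a finite subcover, the index with the least value of \<open>u\<close> is not covered.
\<close>

lemma lsc_attains_min:
  fixes u :: "'a::topological_space \<Rightarrow> real"
  assumes "lsc_on UNIV u" "compact K" "K \<noteq> {}"
  obtains x where "x \<in> K" "\<And>y. y \<in> K \<Longrightarrow> u x \<le> u y"
proof -
  have "\<exists>x\<in>K. \<forall>y\<in>K. u x \<le> u y"
  proof (rule ccontr)
    assume "\<not> ?thesis"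
    then have "K \<subseteq> (\<Union>z\<in>K. {x. u z < u x})"
      by (auto simp: not_le)
    then obtain C where C: "C \<subseteq> K" "finite C" "K \<subseteq> (\<Union>z\<in>C. {x. u z < u x})"
      using assms(1) compactE_image[OF assms(2), of K "\<lambda>z. {x. u z < u x}"]
      by (auto simp: lsc_on_UNIV_iff_open)
    with assms(3) have "C \<noteq> {}" by auto
    with C(2) obtain z where "z \<in> C" "\<And>w. w \<in> C \<Longrightarrow> u z \<le> u w"
      by (metis arg_min_if_finite(1) arg_min_least)
    with C show False by fastforce
  qed
  then show ?thesis using that by blast
qed

section \<open>The Liouville property\<close>

text \<open>
This is the comparison principle on the exterior of a ball. If the supersolution went below the barrier
by an amount \<open>\<eta> > 0\<close>, then, since \<open>u \<ge> 0\<close> and the barrier falls below \<open>\<eta>\<close> on a large sphere, the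
difference would have a minimum inside an annulus. There the barrier is an admissible test function, but
\<open>P_plus k\<close> of its Hessian is positive. The barrier is regularized by \<open>s > 0\<close> because test functions have
to be \<open>C\<^sup>2\<close> on the whole space, including the centre \<open>y\<close>.
\<close>

lemma supersolution_above_barrier:
  fixes u :: "real^'n \<Rightarrow> real"
  assumes nonneg: "\<And>x. 0 \<le> u x" and visc: "viscosity_supersolution (P_plus k) UNIV u"
    and k: "1 \<le> k" "k \<le> 2" "k \<le> CARD('n)"
    and pos: "0 < r" "0 < a" "0 < s" "0 < M" and s: "s < a * r\<^sup>2"
    and sphere: "\<And>x. dist y x = r \<Longrightarrow> M * (s + r\<^sup>2) powr (- a) \<le> u x"
    and x1: "r \<le> dist y x1"
  shows "M * radial_power s (- a) y x1 \<le> u x1"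
proof (rule ccontr)
  define \<phi> where "\<phi> = (\<lambda>x. M * radial_power s (- a) y x)"
  define \<eta> where "\<eta> = \<phi> x1 - u x1"
  assume "\<not> ?thesis"
  then have \<eta>: "0 < \<eta>" by (simp add: \<eta>_def \<phi>_def)
  have "filterlim (\<lambda>t::real. s + t\<^sup>2) at_top at_top"
    by (intro filterlim_tendsto_add_at_top[OF tendsto_const] filterlim_pow_at_top filterlim_ident) simp
  then have "((\<lambda>t. M * (s + t\<^sup>2) powr (- a)) \<longlongrightarrow> M * 0) at_top"
    using pos by (intro tendsto_mult tendsto_const tendsto_neg_powr) auto
  then have "\<forall>\<^sub>F t in at_top. M * (s + t\<^sup>2) powr (- a) < \<eta> \<and> dist y x1 < t"
    using \<eta> by (intro eventually_conj order_tendstoD eventually_gt_at_top) auto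
  then obtain R where R: "M * (s + R\<^sup>2) powr (- a) < \<eta>" "dist y x1 < R"
    using eventually_happens'[OF trivial_limit_at_top_linorder] by blast
  have C2: "C2_on UNIV \<phi>"
    unfolding \<phi>_def using pos by (intro radial_power_C2_and_hessian)
  have "continuous_on UNIV \<phi>"
    using C2 by (simp add: C2_on_def differentiable_imp_continuous_on)
  then have lsc: "lsc_on UNIV (\<lambda>x. u x - \<phi> x)"
    using visc by (intro lsc_on_minus_continuous) (simp_all add: viscosity_supersolution_def)
  define K where "K = cball y R - ball y r"
  have "compact K" "x1 \<in> K"
    using R x1 by (auto simp: K_def intro: compact_diff)
  then obtain x0 where x0: "x0 \<in> K" and min: "\<And>x. x \<in> K \<Longrightarrow> u x0 - \<phi> x0 \<le> u x - \<phi> x"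
    using lsc_attains_min[OF lsc] by (metis empty_iff)
  have neg: "u x0 - \<phi> x0 \<le> - \<eta>"
    using min[OF \<open>x1 \<in> K\<close>] by (simp add: \<eta>_def)
  have \<phi>: "\<phi> x = M * (s + (dist y x)\<^sup>2) powr (- a)" for x
    by (simp add: \<phi>_def radial_power_def dist_norm norm_minus_commute)
  have "dist y x0 \<noteq> r"
    using neg \<eta> sphere[of x0] by (auto simp: \<phi>)
  moreover have "dist y x0 \<noteq> R"
    using neg R(1) nonneg[of x0] by (auto simp: \<phi>)
  ultimately have int: "x0 \<in> ball y R - cball y r"
    using x0 by (auto simp: K_def)
  have "open (ball y R - cball y r)" "ball y R - cball y r \<subseteq> K"
    by (auto simp: K_def)
  with int have "\<forall>\<^sub>F x in at x0. x \<in> K"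
    by (metis (mono_tags, lifting) eventually_at_in_open' eventually_mono subsetD)
  then have "local_min_at UNIV (\<lambda>x. u x - \<phi> x) x0"
    unfolding local_min_at_def by eventually_elim (rule min)
  with C2 visc have "P_plus k (hessian \<phi> x0) \<le> 0"
    by (simp add: viscosity_supersolution_def)
  moreover have "0 < P_plus k (hessian \<phi> x0)"
  proof -
    define t where "t = (norm (x0 - y))\<^sup>2"
    have "r\<^sup>2 \<le> t"
      unfolding t_def using int pos by (intro power_mono) (auto simp: dist_norm norm_minus_commute)
    then have "a * r\<^sup>2 \<le> a * t" "0 \<le> t"
      using pos by (auto simp: t_def)
    moreover have "real k * (s + t) \<le> 2 * (s + t)"
      using k pos \<open>0 \<le> t\<close> by (intro mult_right_mono) auto
    ultimately have "0 < 2 * (a + 1) * t - k * (s + t)"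
      using s by (simp add: algebra_simps)
    moreover have "0 < radial_power s (- a - 2) y x0"
      using radial_power_base_pos[OF pos(3), of "x0 - y"] by (simp add: radial_power_def)
    ultimately show ?thesis
      unfolding \<phi>_def using pos k by (subst P_plus_hessian_radial_power) (auto simp: t_def)
  qed
  ultimately show False by simp
qed

text \<open>
Outside the ball the barrier of exponent \<open>a\<close> is used, normalized to equal \<open>m\<close> on the sphere of radius
\<open>r\<close>, with \<open>s\<close> tied to \<open>a\<close> so that \<open>s < a r\<^sup>2\<close>. As \<open>a\<close> tends to \<open>0\<close> its value at \<open>x\<close> tends to
\<open>m (r\<^sup>2 / |x - y|\<^sup>2)\<^sup>0 = m\<close>.
\<close>

lemma supersolution_min_on_ball_global:
  fixes u :: "real^'n \<Rightarrow> real"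
  assumes nonneg: "\<And>x. 0 \<le> u x" and visc: "viscosity_supersolution (P_plus k) UNIV u"
    and k: "1 \<le> k" "k \<le> 2" "k \<le> CARD('n)"
    and r: "0 < r" and m: "\<And>x. x \<in> cball y r \<Longrightarrow> m \<le> u x"
  shows "m \<le> u x"
  \<comment> \<open>for \<open>m \<le> 0\<close> the claim is the nonnegativity of \<open>u\<close>; the barrier needs \<open>m > 0\<close>\<close>
proof (cases "0 < m \<and> r \<le> dist y x")
  case False
  then show ?thesis using nonneg[of x] m[of x] by (auto simp: not_le)
next
  case True
  then have m0: "0 < m" and x: "r \<le> dist y x" by auto
  define t where "t = (dist y x)\<^sup>2"
  have t: "0 < t" using x r by (auto simp: t_def)
  have "\<forall>\<^sub>F a in at_right 0. m * (((a * r\<^sup>2 / 2 + r\<^sup>2) / (a * r\<^sup>2 / 2 + t)) powr a) \<le> u x"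
    unfolding eventually_at_right_field
  proof (intro exI[of _ 1] conjI allI impI)
    fix a :: real assume a: "0 < a"
    \<comment> \<open>any \<open>s\<close> strictly between \<open>0\<close> and \<open>a r\<^sup>2\<close> that vanishes with \<open>a\<close> would serve\<close>
    define s where "s = a * r\<^sup>2 / 2"
    have s: "0 < s" "s < a * r\<^sup>2" using a r by (auto simp: s_def)
    define M where "M = m * (s + r\<^sup>2) powr a"
    have q: "0 < s + r\<^sup>2" "0 < s + t" using s t by (auto simp: add_pos_nonneg)
    have "M * (s + r\<^sup>2) powr (- a) = m"
      using q by (simp add: M_def powr_minus)
    then have "M * (s + r\<^sup>2) powr (- a) \<le> u z" if "dist y z = r" for z
      using m[of z] that by simp
    moreover have "0 < M" using m0 q by (simp add: M_def)
    ultimately have "M * radial_power s (- a) y x \<le> u x"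
      using supersolution_above_barrier[OF nonneg visc k r a s(1) _ s(2) _ x] by blast
    also have "M * radial_power s (- a) y x = m * ((s + r\<^sup>2) / (s + t)) powr a"
      using q by (simp add: M_def radial_power_def t_def dist_norm norm_minus_commute powr_minus_divide
          powr_divide)
    finally show "m * (((a * r\<^sup>2 / 2 + r\<^sup>2) / (a * r\<^sup>2 / 2 + t)) powr a) \<le> u x"
      by (simp add: s_def)
  qed simp
  moreover have "((\<lambda>a. m * (((a * r\<^sup>2 / 2 + r\<^sup>2) / (a * r\<^sup>2 / 2 + t)) powr a)) \<longlongrightarrow>
      m * (((0 * r\<^sup>2 / 2 + r\<^sup>2) / (0 * r\<^sup>2 / 2 + t)) powr 0)) (at_right 0)"
    using t r by (intro tendsto_intros) auto
  ultimately have "m * (((0 * r\<^sup>2 / 2 + r\<^sup>2) / (0 * r\<^sup>2 / 2 + t)) powr 0) \<le> u x"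
    by (intro tendsto_upperbound) auto
  then show ?thesis using t r by simp
qed

lemma nonneg_supersolution_constant:
  fixes u :: "real^'n \<Rightarrow> real"
  assumes nonneg: "\<And>x. 0 \<le> u x" and visc: "viscosity_supersolution (P_plus k) UNIV u"
    and k: "1 \<le> k" "k \<le> 2" "k \<le> CARD('n)"
  shows "u constant_on UNIV"
proof -
  have lsc: "lsc_on UNIV u"
    using visc by (simp add: viscosity_supersolution_def)
  have ball: "\<exists>z\<in>cball y r. \<forall>x. u z \<le> u x" if "0 < r" for y r
  proof -
    obtain z where "z \<in> cball y r" "\<And>x. x \<in> cball y r \<Longrightarrow> u z \<le> u x"
      using lsc_attains_min[OF lsc, of "cball y r"] \<open>0 < r\<close> by auto
    then show ?thesis
      using supersolution_min_on_ball_global[OF nonneg visc k \<open>0 < r\<close>] by blast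
  qed
  \<comment> \<open>otherwise \<open>u > u x\<close> on a whole ball around \<open>y\<close>, which leaves no global minimum in that ball\<close>
  have "u y \<le> u x" for x y
  proof (rule ccontr)
    assume "\<not> u y \<le> u x"
    then obtain e where e: "0 < e" "cball y e \<subseteq> {z. u x < u z}"
      using lsc by (metis lsc_on_UNIV_iff_open mem_Collect_eq not_le open_contains_cball)
    obtain z where "z \<in> cball y e" "u z \<le> u x"
      using ball[OF e(1)] by blast
    with e(2) show False by auto
  qed
  then show ?thesis
    by (metis constant_on_def order_antisym)
qed

section \<open>Nonconstant solutions and supersolutions\<close>

lemma nonconstant_solution_P_minus:
  fixes i :: "'n::finite"
  assumes "k < CARD('n)"
  defines "u \<equiv> \<lambda>x::real^'n. (x $ i)\<^sup>2"
  shows "classical_solution (P_minus k) UNIV u" "\<not> u constant_on UNIV"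
proof -
  show "classical_solution (P_minus k) UNIV u"
    unfolding u_def classical_solution_def squared_coordinate_C2_and_hessian(2)
    using assms by (simp add: squared_coordinate_C2_and_hessian(1) P_minus_scalar_plus_rank1)
  have "u 0 \<noteq> u (axis i 1)" by (simp add: u_def)
  then show "\<not> u constant_on UNIV" by (metis UNIV_I constant_on_def)
qed

text \<open>
The exponent \<open>a = 1/2\<close> gives \<open>2 (a + 1) = 3\<close>, the largest value that \<open>k\<close> dominates for all
\<open>k \<ge> 3\<close>; the function is \<open>(1 + |x|\<^sup>2)\<^sup>-\<^sup>1\<^sup>/\<^sup>2\<close>.
\<close>

lemma nonconstant_supersolution_P_plus:
  assumes "3 \<le> k" "k \<le> CARD('n)"
  defines "u \<equiv> \<lambda>x::real^'n. radial_power 1 (- 1/2) 0 x"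
  shows "classical_supersolution (P_plus k) UNIV u" "\<not> u constant_on UNIV"
proof -
  have u: "u = (\<lambda>x. 1 * radial_power 1 (- (1/2)) 0 x)"
    by (simp add: u_def)
  have "P_plus k (hessian u x) \<le> 0" for x
  proof -
    define t where "t = (norm x)\<^sup>2"
    have "3 * (1 + t) \<le> k * (1 + t)"
      using assms(1) by (intro mult_right_mono) (auto simp: t_def)
    then have "3 * t - k * (1 + t) \<le> 0" by simp
    then show ?thesis
      unfolding u using assms(1,2)
      by (subst P_plus_hessian_radial_power)
         (auto simp: t_def radial_power_def intro!: mult_nonneg_nonpos)
  qed
  then show "classical_supersolution (P_plus k) UNIV u"
    unfolding classical_supersolution_def
    using radial_power_C2_and_hessian(1)[of 1 1 "- (1/2)" "0::real^'n"] by (simp add: u)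
  have "u 0 \<noteq> u (axis undefined 1)"
    by (simp add: u_def radial_power_def powr_minus powr_half_sqrt)
  then show "\<not> u constant_on UNIV" by (metis UNIV_I constant_on_def)
qed

theorem theorem1p1:
  fixes k :: nat
  assumes "0 < k" and "k < CARD('n::finite)"
  shows "(\<exists>u :: real^'n \<Rightarrow> real.
            (\<forall>x. 0 \<le> u x) \<and> classical_solution (P_minus k) UNIV u \<and> \<not> u constant_on UNIV)
       \<and> (k = 1 \<or> k = 2 \<longrightarrow>
            (\<forall>u :: real^'n \<Rightarrow> real.
               (\<forall>x. 0 \<le> u x) \<and> viscosity_supersolution (P_plus k) UNIV u \<longrightarrow> u constant_on UNIV))
       \<and> (2 < k \<longrightarrow>
            (\<exists>u :: real^'n \<Rightarrow> real.
               (\<forall>x. 0 \<le> u x) \<and> classical_supersolution (P_plus k) UNIV u \<and> \<not> u constant_on UNIV))"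
proof (intro conjI impI allI)
  show "\<exists>u :: real^'n \<Rightarrow> real.
      (\<forall>x. 0 \<le> u x) \<and> classical_solution (P_minus k) UNIV u \<and> \<not> u constant_on UNIV"
    using nonconstant_solution_P_minus[OF assms(2)]
    by (intro exI[of _ "\<lambda>x. (x $ undefined)\<^sup>2"]) simp
next
  fix u :: "real^'n \<Rightarrow> real"
  assume "k = 1 \<or> k = 2" and "(\<forall>x. 0 \<le> u x) \<and> viscosity_supersolution (P_plus k) UNIV u"
  then show "u constant_on UNIV"
    using assms by (intro nonneg_supersolution_constant[of u k]) auto
next
  assume "2 < k"
  then show "\<exists>u :: real^'n \<Rightarrow> real.
      (\<forall>x. 0 \<le> u x) \<and> classical_supersolution (P_plus k) UNIV u \<and> \<not> u constant_on UNIV"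
    using assms(2) nonconstant_supersolution_P_plus[of k, where 'n = 'n]
    by (intro exI[of _ "radial_power 1 (- 1/2) 0"]) (simp add: radial_power_nonneg)
qed

end
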